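(* The projective oriented quadratic form $F=[f,+]$ with $f=[1,1,-1]$ (that is, $F=[1,1,-1,+1]$) is a $\mathrm{PSL}_2(\mathbb Z)$-form, but it is not a $\Gamma_q$-form for any integer $q>3$.
   Context: For an integer $q\ge3$ let $\lambda_q=2\cos(\pi/q)$; the Hecke triangle group $\Gamma_q\subset G=\mathrm{PSL}_2(\mathbb R)$ is generated by $S=\begin{bmatrix}0&1\\-1&0\end{bmatrix}$ and $T_q=\begin{bmatrix}1&\lambda_q\\0&1\end{bmatrix}$; $\Gamma_3=\mathrm{PSL}_2(\mathbb Z)$. $G_h$ is the set of hyperbolic elements of $G$ (those with $|\mathrm{tr}|>2$). For real $A,B,C$ with $B^2-4AC>0$ write $f=[A,B,C]$ for the indefinite quadratic form $Ax^2+Bxy+Cy^2$. A projective oriented quadratic form is a class $[f,s]=\{(f,s),(-f,-s)\}$ with $f=[A,B,C]$ an indefinite quadratic form ($A,B,C$ real, $B^2-4AC>0$) and $s\in\{\pm1\}$, also written $[A,B,C,s]$; $\mathrm{POQF}$ is the set of these. The bijection $\psi_2\colon\mathrm{POQF}\to G_h$ is given by $[A,B,C,s]\mapsto\begin{bmatrix}\frac{-B+s\sqrt{D+4}}2&-C\\ A&\frac{B+s\sqrt{D+4}}2\end{bmatrix}$ with $D=B^2-4AC$. For $\Gamma=\Gamma_q$, a $\Gamma$-form is an element $F\in\mathrm{POQF}$ with $\psi_2(F)\in\Gamma$. *)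

theory Defs
  imports "HOL-Analysis.Analysis" "HOL-Algebra.Generated_Groups"
begin

definition mat2 :: "real \<Rightarrow> real \<Rightarrow> real \<Rightarrow> real \<Rightarrow> real^2^2" where
  "mat2 a b c d = vector [vector [a, b], vector [c, d]]"

definition SL2R :: "(real^2^2) monoid" where
  "SL2R = \<lparr>carrier = {M. det M = 1}, mult = (**), one = mat 1\<rparr>"

definition PSL2R :: "(real^2^2) set monoid" where
  "PSL2R = SL2R Mod {mat 1, - mat 1}"

text \<open>The element of \<^term>\<open>PSL2R\<close> represented by \<open>M\<close>, that is the coset \<open>{M, -M}\<close>
  (see \<open>psl_class_eq\<close> below).\<close>

definition psl_class :: "real^2^2 \<Rightarrow> (real^2^2) set" where
  "psl_class M = {mat 1, - mat 1} #>\<^bsub>SL2R\<^esub> M"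

definition PSL2Z :: "(real^2^2) set set" where
  "PSL2Z = {psl_class (mat2 (of_int a) (of_int b) (of_int c) (of_int d)) | a b c d :: int.
     a * d - b * c = 1}"

definition hecke_lambda :: "nat \<Rightarrow> real" where
  "hecke_lambda q = 2 * cos (pi / real q)"

definition hecke_group :: "nat \<Rightarrow> (real^2^2) set set" where
  "hecke_group q =
     generate PSL2R {psl_class (mat2 0 1 (-1) 0), psl_class (mat2 1 (hecke_lambda q) 0 1)}"

text \<open>The triple \<open>(A, B, C)\<close> stands for the quadratic form $Ax^2 + Bxy + Cy^2$.\<close>

type_synonym qform = "real \<times> real \<times> real"

fun disc :: "qform \<Rightarrow> real" where
  "disc (A, B, C) = B^2 - 4 * A * C"

definition indefinite :: "qform \<Rightarrow> bool" where
  "indefinite f \<longleftrightarrow> disc f > 0"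

definition poqf :: "qform \<Rightarrow> int \<Rightarrow> (qform \<times> int) set" where
  "poqf f s = {(f, s), (- f, - s)}"

definition POQF :: "(qform \<times> int) set set" where
  "POQF = {poqf f s | f s. indefinite f \<and> s \<in> {1, -1}}"

fun psi2_matrix :: "qform \<times> int \<Rightarrow> real^2^2" where
  "psi2_matrix ((A, B, C), s) =
     (let r = of_int s * sqrt (disc (A, B, C) + 4)
      in mat2 ((- B + r) / 2) (- C) A ((B + r) / 2))"

text \<open>Both representatives of a projective oriented form have the same image in
  \<^term>\<open>PSL2R\<close>, so \<^const>\<open>the_elem\<close> picks the element of a singleton
  (see \<open>psi2_poqf\<close> below).\<close>

definition psi2 :: "(qform \<times> int) set \<Rightarrow> (real^2^2) set" where
  "psi2 F = the_elem ((\<lambda>x. psl_class (psi2_matrix x)) ` F)"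

definition is_group_form :: "(real^2^2) set set \<Rightarrow> (qform \<times> int) set \<Rightarrow> bool" where
  "is_group_form \<Gamma> F \<longleftrightarrow> F \<in> POQF \<and> psi2 F \<in> \<Gamma>"

lemma mat2_nth [simp]:
  "mat2 a b c d $ 1 $ 1 = a" "mat2 a b c d $ 1 $ 2 = b"
  "mat2 a b c d $ 2 $ 1 = c" "mat2 a b c d $ 2 $ 2 = d"
  by (simp_all add: mat2_def)

lemma mat2_mult: "mat2 a b c d ** mat2 a' b' c' d' =
    mat2 (a * a' + b * c') (a * b' + b * d') (c * a' + d * c') (c * b' + d * d')"
  by (simp add: vec_eq_iff forall_2 matrix_matrix_mult_def sum_2)

lemma mat2_uminus: "- mat2 a b c d = mat2 (-a) (-b) (-c) (-d)"
  by (simp add: vec_eq_iff forall_2)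

lemma mat2_one: "mat 1 = mat2 1 0 0 1"
  by (simp add: vec_eq_iff forall_2 mat_def)

lemma det_mat2: "det (mat2 a b c d) = a * d - b * c"
  by (simp add: det_2)

lemma det_uminus2: "det (- M) = det (M :: real^2^2)"
  by (simp add: det_2)

lemma neg_mult_left: "(- A) ** B = - (A ** B :: real^2^2)"
  by (simp add: vec_eq_iff matrix_matrix_mult_def sum_negf)

lemma neg_mult_right: "A ** (- B) = - (A ** B :: real^2^2)"
  by (simp add: vec_eq_iff matrix_matrix_mult_def sum_negf)

lemma group_SL2R: "group SL2R"
proof (rule groupI)
  fix M assume "M \<in> carrier SL2R"
  then have d: "det M = 1" by (simp add: SL2R_def)
  then have "invertible M" by (simp add: invertible_det_nz)
  then obtain N where N: "N ** M = mat 1" unfolding invertible_def by auto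
  then have "det N * det M = 1" by (metis det_mul det_I)
  then show "\<exists>N\<in>carrier SL2R. N \<otimes>\<^bsub>SL2R\<^esub> M = \<one>\<^bsub>SL2R\<^esub>" using N d
    by (auto simp: SL2R_def)
qed (auto simp: SL2R_def det_mul matrix_mul_assoc)

lemma normal_pm1: "{mat 1, - mat 1} \<lhd> SL2R"
proof -
  interpret group SL2R by (rule group_SL2R)
  have "inv\<^bsub>SL2R\<^esub> (- mat 1) = - mat 1" "inv\<^bsub>SL2R\<^esub> (mat 1) = mat 1"
    by (rule inv_equality; simp add: SL2R_def det_uminus2 neg_mult_left neg_mult_right)+
  then have "subgroup {mat 1, - mat 1} SL2R"
    by (intro subgroupI) (auto simp: SL2R_def det_uminus2 neg_mult_left neg_mult_right)
  then show ?thesis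
    by (rule normalI[rule_format])
       (auto simp: SL2R_def r_coset_def l_coset_def neg_mult_left neg_mult_right)
qed

lemma group_PSL2R: "group PSL2R"
  unfolding PSL2R_def by (rule normal.factorgroup_is_group[OF normal_pm1])

lemma psl_class_eq: "psl_class M = {M, - M}"
  by (auto simp: psl_class_def r_coset_def SL2R_def neg_mult_left)

lemma psl_class_uminus: "psl_class (- M) = psl_class M"
  by (auto simp: psl_class_eq)

lemma carrier_PSL2R: "carrier PSL2R = psl_class ` {M. det M = 1}"
  by (auto simp: PSL2R_def FactGroup_def RCOSETS_def psl_class_def SL2R_def)

lemma psl_class_mult:
  assumes "det M = 1" "det N = 1"
  shows "psl_class M \<otimes>\<^bsub>PSL2R\<^esub> psl_class N = psl_class (M ** N)"
  using normal.rcos_sum[OF normal_pm1, of M N] assms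
  by (simp add: PSL2R_def FactGroup_def psl_class_def) (simp add: SL2R_def)

lemma psi2_poqf: "psi2 (poqf f s) = psl_class (psi2_matrix (f, s))"
proof -
  obtain A B C where f: "f = (A, B, C)" by (cases f)
  have "psi2_matrix (- f, - s) = - psi2_matrix (f, s)"
    by (simp add: f mat2_uminus Let_def vec_eq_iff forall_2 field_simps)
  then have "(\<lambda>x. psl_class (psi2_matrix x)) ` poqf f s = {psl_class (psi2_matrix (f, s))}"
    by (simp add: poqf_def psl_class_uminus)
  then show ?thesis by (simp add: psi2_def)
qed

lemma psi2_in_PSL2R:
  assumes "F \<in> POQF"
  shows "psi2 F \<in> carrier PSL2R"
proof -
  from assms obtain A B C s where F: "F = poqf (A, B, C) s" and D: "disc (A, B, C) > 0"
    and s: "s = 1 \<or> s = -1"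
    by (auto simp: POQF_def indefinite_def)
  have "(sqrt (B^2 - 4 * A * C + 4))^2 = B^2 - 4 * A * C + 4" using D by simp
  then have "det (psi2_matrix ((A, B, C), s)) = 1"
    using s by (auto simp: Let_def det_mat2 power2_eq_square field_simps)
  then show ?thesis by (auto simp: F psi2_poqf carrier_PSL2R)
qed

lemma hecke_group_3: "hecke_group 3 = PSL2Z"
proof -
  interpret P: group PSL2R by (rule group_PSL2R)
  have l: "hecke_lambda 3 = 1" by (simp add: hecke_lambda_def cos_60)
  let ?S = "mat2 0 1 (-1) 0" and ?T = "\<lambda>k. mat2 1 (of_int k) 0 1"
  let ?G = "{psl_class ?S, psl_class (?T 1)}"
  have G: "hecke_group 3 = generate PSL2R ?G" by (simp add: hecke_group_def l)
  have Gc: "?G \<subseteq> carrier PSL2R" by (auto simp: carrier_PSL2R det_mat2)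
  have sub: "subgroup (generate PSL2R ?G) PSL2R" by (rule P.generate_is_subgroup[OF Gc])
  have one: "\<one>\<^bsub>PSL2R\<^esub> = psl_class (mat 1)"
    by (auto simp: PSL2R_def FactGroup_def psl_class_eq)
  have inv: "inv\<^bsub>PSL2R\<^esub> (psl_class (mat2 a b c d)) = psl_class (mat2 d (-b) (-c) a)"
    if "a * d - b * c = 1" for a b c d
    using that by (intro P.inv_equality)
      (auto simp: carrier_PSL2R det_mat2 psl_class_mult mat2_mult one mat2_one algebra_simps)
  have "subgroup PSL2Z PSL2R"
  proof (rule P.subgroupI)
    show "PSL2Z \<subseteq> carrier PSL2R"
      by (auto simp: PSL2Z_def carrier_PSL2R det_mat2 simp flip: of_int_mult of_int_diff)
    have "psl_class (mat2 (of_int 1) (of_int 0) (of_int 0) (of_int 1)) \<in> PSL2Z"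
      unfolding PSL2Z_def by (intro CollectI exI conjI, rule refl) simp
    then show "PSL2Z \<noteq> {}" by blast
  next
    fix X assume "X \<in> PSL2Z"
    then obtain a b c d :: int where X: "X = psl_class (mat2 a b c d)" and d: "a * d - b * c = 1"
      by (auto simp: PSL2Z_def)
    have "inv\<^bsub>PSL2R\<^esub> X = psl_class (mat2 (of_int d) (of_int (-b)) (of_int (-c)) (of_int a))"
      unfolding X using d by (subst inv) (simp_all flip: of_int_mult of_int_diff)
    moreover have "d * a - (-b) * (-c) = 1" using d by (simp add: algebra_simps)
    ultimately show "inv\<^bsub>PSL2R\<^esub> X \<in> PSL2Z" unfolding PSL2Z_def by blast
  next
    fix X Y assume "X \<in> PSL2Z" "Y \<in> PSL2Z"
    then obtain a b c d a' b' c' d' :: int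
      where X: "X = psl_class (mat2 a b c d)" and d: "a * d - b * c = 1"
        and Y: "Y = psl_class (mat2 a' b' c' d')" and d': "a' * d' - b' * c' = 1"
      by (auto simp: PSL2Z_def)
    have "X \<otimes>\<^bsub>PSL2R\<^esub> Y = psl_class (mat2 (of_int (a * a' + b * c')) (of_int (a * b' + b * d'))
        (of_int (c * a' + d * c')) (of_int (c * b' + d * d')))"
      unfolding X Y using d d'
      by (subst psl_class_mult) (simp_all add: det_mat2 mat2_mult flip: of_int_mult of_int_diff)
    moreover have "(a * a' + b * c') * (c * b' + d * d') - (a * b' + b * d') * (c * a' + d * c')
        = (a * d - b * c) * (a' * d' - b' * c')" by (simp add: algebra_simps)
    then have "(a * a' + b * c') * (c * b' + d * d') - (a * b' + b * d') * (c * a' + d * c') = 1"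
      by (simp add: d d')
    ultimately show "X \<otimes>\<^bsub>PSL2R\<^esub> Y \<in> PSL2Z" unfolding PSL2Z_def by blast
  qed
  moreover have "psl_class ?S = psl_class (mat2 (of_int 0) (of_int 1) (of_int (-1)) (of_int 0))"
    "psl_class (?T 1) = psl_class (mat2 (of_int 1) (of_int 1) (of_int 0) (of_int 1))" by simp_all
  then have "?G \<subseteq> PSL2Z" unfolding PSL2Z_def by fastforce
  ultimately have "hecke_group 3 \<subseteq> PSL2Z" unfolding G by (rule P.generate_subgroup_incl[rotated])
  moreover have "PSL2Z \<subseteq> hecke_group 3"
  proof -
    let ?K = "generate PSL2R ?G"
    have S: "psl_class ?S \<in> ?K" and T1: "psl_class (?T 1) \<in> ?K"
      by (auto intro: generate.incl)
    have mul: "psl_class (M ** N) \<in> ?K"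
      if "psl_class M \<in> ?K" "psl_class N \<in> ?K" "det M = 1" "det N = 1" for M N
      using subgroup.m_closed[OF sub that(1,2)] that(3,4) by (simp add: psl_class_mult)
    have Ti: "psl_class (?T (-1)) \<in> ?K"
      using subgroup.m_inv_closed[OF sub T1] by (simp add: inv)
    have T: "psl_class (?T k) \<in> ?K" for k
    proof (induction k rule: int_induct[where k = 0])
      case base
      show ?case using subgroup.one_closed[OF sub] by (simp add: one mat2_one)
    next
      case (step1 i)
      show ?case using mul[OF step1(2) T1] by (simp add: det_mat2 mat2_mult add.commute)
    next
      case (step2 i)
      show ?case using mul[OF step2(2) Ti] by (simp add: det_mat2 mat2_mult add.commute)
    qed
    have "psl_class (mat2 a b c d) \<in> ?K" if "a * d - b * c = 1" for a b c d :: int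
      using that
    proof (induction "nat \<bar>c\<bar>" arbitrary: a b c d rule: less_induct)
      case less
      show ?case
      proof (cases "c = 0")
        case True
        then have "a * d = 1" using less.prems by simp
        then have "a = 1 \<and> d = 1 \<or> a = -1 \<and> d = -1" by (auto simp: zmult_eq_1_iff)
        moreover have "psl_class (mat2 (-1) (of_int b) 0 (-1)) = psl_class (?T (-b))"
          by (subst psl_class_uminus[symmetric]) (simp add: mat2_uminus)
        ultimately show ?thesis using True T[of b] T[of "-b"] by auto
      next
        case False
        define k where "k = a div c"
        define r where "r = a mod c"
        have a: "a = k * c + r" by (simp add: k_def r_def)
        have r: "nat \<bar>-r\<bar> < nat \<bar>c\<bar>"
          using False abs_mod_less[of c a] by (simp add: r_def)
        let ?u = "b - k * d"
        have det: "c * (- ?u) - d * (- r) = 1"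
          using less.prems by (simp add: a algebra_simps)
        have "psl_class (mat2 (of_int c) (of_int d) (of_int (-r)) (of_int (- ?u))) \<in> ?K"
          by (rule less.hyps[OF r det])
        moreover have dd: "det (mat2 (of_int c) (of_int d) (of_int (-r)) (of_int (- ?u))) = 1"
          unfolding det_mat2 using det by (metis of_int_1 of_int_diff of_int_mult)
        ultimately have "psl_class ((?T k ** ?S) **
            mat2 (of_int c) (of_int d) (of_int (-r)) (of_int (- ?u))) \<in> ?K"
          by (intro mul T S) (simp_all add: det_mat2 det_mul)
        moreover have "(?T k ** ?S) ** mat2 (of_int c) (of_int d) (of_int (-r)) (of_int (- ?u))
            = - mat2 a b c d"
          by (simp add: mat2_mult mat2_uminus a algebra_simps)
        ultimately show ?thesis by (simp add: psl_class_uminus)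
      qed
    qed
    then show ?thesis by (auto simp: PSL2Z_def G)
  qed
  ultimately show ?thesis by blast
qed

end

theory Submission
  imports Defs
begin

text \<open>
  Under \<^const>\<open>psi2\<close> the form \<open>[1,1,-1,+]\<close> becomes the class of the matrix \<open>N\<close> with rows
  \<open>(1, 1)\<close> and \<open>(1, 2)\<close>. It is integral, so it lies in \<^const>\<open>PSL2Z\<close>. If it were in
  \<^term>\<open>hecke_group q\<close>, its first column \<open>(1, 1)\<close> would lie in the orbit of the vector \<open>(1, 0)\<close>
  under the matrices of the Hecke group (signs included); for \<open>q > 3\<close> that orbit avoids \<open>(1, 1)\<close>.

  To see this, put \<open>U = T S\<close>, which has order \<open>q\<close> up to sign. The matrices
  \<open>A\<^sub>k = \<plusminus>U\<^sup>k S\<close> for \<open>1 \<le> k < q\<close> have nonnegative entries: they are built from the numbers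
  \<open>s\<^sub>k = sin (k \<pi> / q) / sin (\<pi> / q)\<close>. They cut the closed first quadrant into \<open>q - 1\<close> sectors,
  each of them an image of the whole quadrant. Let \<open>V\<close> be the set of vectors obtained from \<open>(1, 0)\<close>
  by repeatedly applying the \<open>A\<^sub>k\<close>. As \<open>U A\<^sub>k = \<plusminus>A\<^bsub>k+1\<^esub>\<close>, with \<open>U A\<^bsub>q-1\<^esub> = \<plusminus>S\<close>, the set
  \<open>\<plusminus>V \<union> \<plusminus>S V\<close> is stable under \<open>S\<close> and \<open>T\<close> and their inverses (lemma
  \<open>hecke_group_stabilizes\<close>), hence it contains the orbit of \<open>(1, 0)\<close>.

  Vectors of \<open>\<plusminus>S V\<close> never have two coordinates of the same strict sign. A vector of \<open>V\<close> other than
  \<open>(1, 0)\<close> has both coordinates at least \<open>1\<close> and sum larger than \<open>2\<close> (lemma \<open>quadrant_orbit_bounds\<close>):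
  this holds for the first columns of the \<open>A\<^sub>k\<close>, because \<open>s\<^sub>k > 1\<close> for \<open>2 \<le> k \<le> q - 2\<close> while
  \<open>s\<^sub>1 = s\<^bsub>q-1\<^esub> = 1\<close>, and no \<open>A\<^sub>k\<close> decreases a coordinate of a nonnegative vector. The range
  \<open>2 \<le> k \<le> q - 2\<close> is nonempty exactly when \<open>q > 3\<close>; for \<open>q = 3\<close> the vector \<open>(1, 1)\<close> is the first
  column of \<open>A\<^sub>2\<close>.
\<close>

section \<open>Sine quotients\<close>

definition sine_quotient :: "nat \<Rightarrow> nat \<Rightarrow> real" where
  "sine_quotient q k = sin (real k * (pi / real q)) / sin (pi / real q)"

lemma sin_pi_div_pos: "q \<ge> 2 \<Longrightarrow> sin (pi / real q) > 0"
  by (rule sin_gt_zero) (auto simp: field_simps)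

lemma sine_quotient_0 [simp]: "sine_quotient q 0 = 0"
  by (simp add: sine_quotient_def)

lemma sine_quotient_1 [simp]: "q \<ge> 2 \<Longrightarrow> sine_quotient q (Suc 0) = 1"
  using sin_pi_div_pos[of q] by (simp add: sine_quotient_def)

lemma sine_quotient_refl [simp]: "q \<ge> 2 \<Longrightarrow> sine_quotient q q = 0"
  by (simp add: sine_quotient_def)

lemma sine_quotient_reflect:
  assumes "q \<ge> 2" "k \<le> q"
  shows "sine_quotient q (q - k) = sine_quotient q k"
proof -
  have "real (q - k) * (pi / real q) = pi - real k * (pi / real q)"
    using assms by (simp add: of_nat_diff field_simps)
  then show ?thesis by (simp add: sine_quotient_def)
qed

lemma sine_quotient_rec:
  "sine_quotient q (Suc (Suc k)) =
     hecke_lambda q * sine_quotient q (Suc k) - sine_quotient q k"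
proof -
  define t where "t = pi / real q"
  define u where "u = real (Suc k) * t"
  have "real (Suc (Suc k)) * t = u + t" "real k * t = u - t"
    by (simp_all add: u_def algebra_simps)
  then have "sin (real (Suc (Suc k)) * t) = 2 * cos t * sin u - sin (real k * t)"
    by (simp add: sin_add sin_diff)
  then show ?thesis
    by (simp add: sine_quotient_def hecke_lambda_def t_def u_def diff_divide_distrib)
qed

lemma sine_quotient_nonneg: "q \<ge> 2 \<Longrightarrow> k \<le> q \<Longrightarrow> sine_quotient q k \<ge> 0"
  unfolding sine_quotient_def
  by (intro divide_nonneg_pos sin_ge_zero sin_pi_div_pos) (auto simp: field_simps)

text \<open>With \<open>t = \<pi> / q\<close>, the angle \<open>k t\<close> lies strictly between \<open>t\<close> and \<open>\<pi> - t\<close>, where the sine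
  exceeds \<open>sin t\<close>.\<close>

lemma sine_quotient_gt_1:
  assumes "2 \<le> k" "k + 2 \<le> q"
  shows "sine_quotient q k > 1"
proof -
  define t where "t = pi / real q"
  have q: "real q > 0" and pi: "pi = real q * t" using assms by (simp_all add: t_def)
  then have t: "t > 0" by (metis pi_gt_zero zero_less_mult_pos)
  have kt: "real k * t - t > 0" "real k * t + t < pi" "real k * t - t < pi"
  proof -
    have "real k * t - t = (real k - 1) * t" by (simp add: algebra_simps)
    also have "\<dots> > 0" using t assms by simp
    finally show "real k * t - t > 0" .
    have "real k * t + t = (real k + 1) * t" by (simp add: algebra_simps)
    also have "\<dots> < real q * t" using t assms by (intro mult_strict_right_mono) auto
    finally show "real k * t + t < pi" using pi by simp
    then show "real k * t - t < pi" using t by simp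
  qed
  have "sin (real k * t) - sin t = 2 * sin ((real k * t - t) / 2) * cos ((real k * t + t) / 2)"
    by (rule sin_diff_sin)
  also have "\<dots> > 0"
  proof -
    have "0 < (real k * t - t) / 2" "(real k * t - t) / 2 < pi"
      "0 < (real k * t + t) / 2" "(real k * t + t) / 2 < pi / 2"
      using kt t by argo+
    then show ?thesis by (intro mult_pos_pos sin_gt_zero cos_gt_zero) simp_all
  qed
  finally show ?thesis
    using sin_pi_div_pos[of q] assms by (simp add: sine_quotient_def t_def field_simps)
qed

lemma sine_quotient_ge_1:
  assumes "1 \<le> k" "k < q"
  shows "sine_quotient q k \<ge> 1"
proof -
  consider "k = 1" | "k = q - 1" | "2 \<le> k" "k + 2 \<le> q" using assms by linarith
  then show ?thesis
  proof cases
    case 3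
    then show ?thesis using sine_quotient_gt_1[of k q] by simp
  qed (use assms sine_quotient_reflect[of q 1] in auto)
qed

section \<open>The orbit of the first basis vector in the first quadrant\<close>

text \<open>Up to sign this is \<open>(T S)\<^bsup>k+1\<^esup> S\<close>; the shift of the index avoids subtraction.\<close>

definition sector_matrix :: "nat \<Rightarrow> nat \<Rightarrow> real^2^2" where
  "sector_matrix q k =
     mat2 (sine_quotient q (Suc k)) (sine_quotient q (Suc (Suc k)))
          (sine_quotient q k) (sine_quotient q (Suc k))"

inductive_set quadrant_orbit :: "nat \<Rightarrow> (real^2) set" for q where
  base: "vector [1, 0] \<in> quadrant_orbit q"
| step: "v \<in> quadrant_orbit q \<Longrightarrow> k + 2 \<le> q \<Longrightarrow> sector_matrix q k *v v \<in> quadrant_orbit q"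

abbreviation matS :: "real^2^2" where
  "matS \<equiv> mat2 0 1 (-1) 0"

abbreviation matT :: "nat \<Rightarrow> real^2^2" where
  "matT q \<equiv> mat2 1 (hecke_lambda q) 0 1"

abbreviation matT' :: "nat \<Rightarrow> real^2^2" where
  "matT' q \<equiv> mat2 1 (- hecke_lambda q) 0 1"

definition full_orbit :: "nat \<Rightarrow> (real^2) set" where
  "full_orbit q = (\<Union>v\<in>quadrant_orbit q. {v, - v, matS *v v, - (matS *v v)})"

lemma mat2_vector: "mat2 a b c d *v v = vector [a * v$1 + b * v$2, c * v$1 + d * v$2]"
  by (simp add: vec_eq_iff forall_2 matrix_vector_mult_def sum_2)

lemma neg_matrix_vector: "(- M) *v v = - (M *v v)" for M :: "real^2^2"
  by (simp add: vec_eq_iff forall_2 matrix_vector_mult_def sum_2)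

lemma matrix_vector_neg: "M *v (- v) = - (M *v v)" for M :: "real^2^2"
  by (simp add: vec_eq_iff forall_2 matrix_vector_mult_def sum_2)

text \<open>The strict bound starts with the columns \<open>(s\<^bsub>k+1\<^esub>, s\<^sub>k)\<close>: of two consecutive indices between
  \<open>1\<close> and \<open>q - 1\<close>, at least one lies between \<open>2\<close> and \<open>q - 2\<close> when \<open>q > 3\<close>. Afterwards the diagonal
  entries, which are at least \<open>1\<close>, keep the coordinates from decreasing.\<close>

lemma quadrant_orbit_bounds:
  assumes "v \<in> quadrant_orbit q" "q > 3"
  shows "v$1 = 1 \<and> v$2 = 0 \<or> v$1 \<ge> 1 \<and> v$2 \<ge> 1 \<and> v$1 + v$2 > 2"
  using assms(1)
proof induction
  case base
  then show ?case by simp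
next
  case (step v k)
  let ?a = "sine_quotient q k" and ?b = "sine_quotient q (Suc k)"
    and ?c = "sine_quotient q (Suc (Suc k))"
  have b: "?b \<ge> 1" and a: "?a \<ge> 0" and c: "?c \<ge> 0"
    using step.hyps sine_quotient_ge_1[of "Suc k" q] sine_quotient_nonneg[of q] by simp_all
  have v: "(sector_matrix q k *v v)$1 = ?b * v$1 + ?c * v$2"
    "(sector_matrix q k *v v)$2 = ?a * v$1 + ?b * v$2"
    by (simp_all add: sector_matrix_def mat2_vector)
  from step.IH show ?case
  proof
    assume e: "v$1 = 1 \<and> v$2 = 0"
    show ?thesis
    proof (cases "k = 0")
      case True
      then show ?thesis using e assms by (simp add: sector_matrix_def mat2_vector)
    next
      case False
      then have "?a \<ge> 1" using step.hyps sine_quotient_ge_1[of k q] by simp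
      moreover have "?a > 1 \<or> ?b > 1"
        using False step.hyps assms sine_quotient_gt_1[of k q] sine_quotient_gt_1[of "Suc k" q]
        by (cases "k = 1") auto
      ultimately show ?thesis using e b by (auto simp: v)
    qed
  next
    assume g: "v$1 \<ge> 1 \<and> v$2 \<ge> 1 \<and> v$1 + v$2 > 2"
    have "1 * v$1 \<le> ?b * v$1" "1 * v$2 \<le> ?b * v$2"
      using g b by (auto intro!: mult_right_mono)
    moreover have "?c * v$2 \<ge> 0" "?a * v$1 \<ge> 0" using g a c by auto
    ultimately have "v$1 \<le> ?b * v$1 + ?c * v$2" "v$2 \<le> ?a * v$1 + ?b * v$2" by linarith+
    then show ?thesis using g by (simp add: v)
  qed
qed

lemma one_one_notin_full_orbit:
  assumes "q > 3"
  shows "vector [1, 1] \<notin> full_orbit q"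
proof
  assume "vector [1, 1] \<in> full_orbit q"
  then obtain v where v: "v \<in> quadrant_orbit q"
    and w: "vector [1, 1] \<in> {v, - v, matS *v v, - (matS *v v)}"
    by (auto simp: full_orbit_def)
  have "v$1 = 1 \<and> v$2 = 1 \<or> v$1 = -1 \<and> v$2 = -1 \<or> v$2 = 1 \<and> v$1 = -1 \<or> v$2 = -1 \<and> v$1 = 1"
    using w by (auto simp: vec_eq_iff forall_2 mat2_vector)
  with quadrant_orbit_bounds[OF v assms] show False by auto
qed

section \<open>Stability under the Hecke group\<close>

definition stabilizes :: "nat \<Rightarrow> real^2^2 \<Rightarrow> bool" where
  "stabilizes q M \<longleftrightarrow> (\<forall>v\<in>full_orbit q. M *v v \<in> full_orbit q)"

lemma full_orbit_uminus: "v \<in> full_orbit q \<Longrightarrow> - v \<in> full_orbit q"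
  by (auto simp: full_orbit_def)

lemma full_orbitI:
  assumes "v \<in> quadrant_orbit q"
  shows "v \<in> full_orbit q" "matS *v v \<in> full_orbit q"
  using assms by (auto simp: full_orbit_def)

lemma stabilizesI:
  assumes "\<And>v. v \<in> quadrant_orbit q \<Longrightarrow> M *v v \<in> full_orbit q"
    and "\<And>v. v \<in> quadrant_orbit q \<Longrightarrow> (M ** matS) *v v \<in> full_orbit q"
  shows "stabilizes q M"
  using assms full_orbit_uminus[of _ q]
  by (auto simp: stabilizes_def full_orbit_def[of q] matrix_vector_neg matrix_vector_mul_assoc)

lemma stabilizes_uminus: "stabilizes q M \<Longrightarrow> stabilizes q (- M)"
  by (auto simp: stabilizes_def neg_matrix_vector full_orbit_uminus)

lemma stabilizes_mult: "stabilizes q M \<Longrightarrow> stabilizes q N \<Longrightarrow> stabilizes q (M ** N)"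
  by (auto simp: stabilizes_def simp flip: matrix_vector_mul_assoc)

lemma stabilizes_S: "stabilizes q matS"
proof (rule stabilizesI)
  fix v assume v: "v \<in> quadrant_orbit q"
  show "matS *v v \<in> full_orbit q" using v by (rule full_orbitI)
  have "matS ** matS = - mat 1" by (simp add: mat2_mult mat2_one mat2_uminus)
  then show "(matS ** matS) *v v \<in> full_orbit q"
    using full_orbit_uminus[OF full_orbitI(1)[OF v]] by (simp add: neg_matrix_vector)
qed

text \<open>\<open>T\<close> is itself a sector matrix, and \<open>T S\<close> moves each sector to the next one; past the last
  sector it arrives at \<open>S\<close>.\<close>

lemma stabilizes_T:
  assumes "q \<ge> 3"
  shows "stabilizes q (matT q)"
proof (rule stabilizesI)
  fix v assume v: "v \<in> quadrant_orbit q"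
  have s2: "sine_quotient q (Suc (Suc 0)) = hecke_lambda q"
    using assms sine_quotient_rec[of q 0] by simp
  have "matT q = sector_matrix q 0"
    using assms s2 by (simp add: sector_matrix_def)
  then show "matT q *v v \<in> full_orbit q"
    using quadrant_orbit.step[OF v, of 0] assms by (auto intro: full_orbitI)
  from v show "(matT q ** matS) *v v \<in> full_orbit q"
  proof cases
    case base
    have "(matT q ** matS) *v v = - (sector_matrix q 1 *v v)"
      using assms s2 base
      by (simp add: sector_matrix_def mat2_mult mat2_vector vec_eq_iff forall_2)
    then show ?thesis using quadrant_orbit.step[OF v, of 1] assms
      by (simp add: full_orbit_uminus full_orbitI)
  next
    case (step w k)
    have m: "matT q ** matS ** sector_matrix q k = - sector_matrix q (Suc k)"
      using sine_quotient_rec[of q k] sine_quotient_rec[of q "Suc k"]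
      by (simp add: sector_matrix_def mat2_mult mat2_uminus)
    have e: "(matT q ** matS) *v v = - (sector_matrix q (Suc k) *v w)"
      by (simp add: step(1) matrix_vector_mul_assoc m neg_matrix_vector)
    show ?thesis
    proof (cases "Suc k + 2 \<le> q")
      case True
      then show ?thesis unfolding e
        by (intro full_orbit_uminus full_orbitI quadrant_orbit.step step(2))
    next
      case False
      then have q: "q = Suc (Suc k)" using step by simp
      have one: "sine_quotient q (Suc k) = 1"
        using sine_quotient_reflect[of q 1] assms q by simp
      have zero: "sine_quotient q (Suc (Suc k)) = 0"
        using assms sine_quotient_refl[of q] unfolding q by simp
      have "sector_matrix q (Suc k) = - matS"
        using sine_quotient_rec[of q "Suc k"] one zero
        by (simp add: sector_matrix_def mat2_uminus)
      then show ?thesis unfolding e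
        using full_orbitI(2)[OF step(2)] by (simp add: neg_matrix_vector)
    qed
  qed
qed

text \<open>Inverting \<open>U A\<^sub>k = \<plusminus>A\<^bsub>k+1\<^esub>\<close> for \<open>U = T S\<close> gives
  \<open>T\<^bsup>-1\<^esup> A\<^bsub>k+1\<^esub> = \<plusminus>S A\<^sub>k\<close> and, at the end of the chain,
  \<open>T\<^bsup>-1\<^esup> S = \<plusminus>S A\<^bsub>q-1\<^esub>\<close>.\<close>

lemma stabilizes_T_inv:
  assumes "q \<ge> 3"
  shows "stabilizes q (matT' q)"
proof (rule stabilizesI)
  fix v assume v: "v \<in> quadrant_orbit q"
  from v show "matT' q *v v \<in> full_orbit q"
  proof cases
    case base
    then have "matT' q *v v = v" by (simp add: mat2_vector)
    then show ?thesis using v by (simp add: full_orbitI)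
  next
    case (step w k)
    show ?thesis
    proof (cases k)
      case 0
      have "matT' q ** sector_matrix q 0 = mat 1"
        using assms sine_quotient_rec[of q 0]
        by (simp add: sector_matrix_def mat2_mult mat2_one)
      then have "matT' q *v v = w"
        by (simp add: step(1) 0 matrix_vector_mul_assoc)
      then show ?thesis using step by (simp add: full_orbitI)
    next
      case (Suc j)
      have "matT' q ** sector_matrix q (Suc j) = - (matS ** sector_matrix q j)"
        using sine_quotient_rec[of q j] sine_quotient_rec[of q "Suc j"]
        by (simp add: sector_matrix_def mat2_mult mat2_uminus)
      then have e: "matT' q *v v = - (matS *v (sector_matrix q j *v w))"
        by (simp add: step(1) Suc matrix_vector_mul_assoc neg_matrix_vector)
      show ?thesis unfolding e using step Suc
        by (intro full_orbit_uminus full_orbitI quadrant_orbit.step) auto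
    qed
  qed
  define k where "k = q - 2"
  have q: "q = Suc (Suc k)" using assms by (simp add: k_def)
  have one: "sine_quotient q (Suc k) = 1"
    using sine_quotient_reflect[of q 1] assms q by simp
  have zero: "sine_quotient q (Suc (Suc k)) = 0"
    using assms sine_quotient_refl[of q] unfolding q by simp
  have "matT' q ** matS = matS ** sector_matrix q k"
    using sine_quotient_rec[of q k] one zero by (simp add: sector_matrix_def mat2_mult)
  then have e: "(matT' q ** matS) *v v = matS *v (sector_matrix q k *v v)"
    by (simp add: matrix_vector_mul_assoc)
  show "(matT' q ** matS) *v v \<in> full_orbit q" unfolding e
    by (intro full_orbitI quadrant_orbit.step v) (simp add: q)
qed

lemma one_PSL2R: "\<one>\<^bsub>PSL2R\<^esub> = psl_class (mat 1)"
  by (auto simp: PSL2R_def FactGroup_def psl_class_eq)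

lemma inv_psl_class:
  assumes "a * d - b * c = 1"
  shows "inv\<^bsub>PSL2R\<^esub> (psl_class (mat2 a b c d)) = psl_class (mat2 d (-b) (-c) a)"
  using assms by (intro group.inv_equality[OF group_PSL2R])
    (auto simp: carrier_PSL2R det_mat2 psl_class_mult mat2_mult one_PSL2R mat2_one algebra_simps)

lemma hecke_group_stabilizes:
  assumes "X \<in> hecke_group q" "q \<ge> 3"
  shows "\<exists>M. X = psl_class M \<and> det M = 1 \<and> stabilizes q M"
  using assms(1) unfolding hecke_group_def
proof (induction rule: generate.induct)
  case one
  show ?case by (intro exI[of _ "mat 1"]) (simp add: one_PSL2R stabilizes_def)
next
  case (incl h)
  then show ?case
    using stabilizes_S[of q] stabilizes_T[OF assms(2)] by (auto simp: det_mat2)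
next
  case (inv h)
  then consider "h = psl_class matS" | "h = psl_class (matT q)" by auto
  then show ?case
  proof cases
    case 1
    then show ?thesis
      using stabilizes_uminus[OF stabilizes_S[of q]]
      by (intro exI[of _ "- matS"]) (simp add: inv_psl_class det_mat2 mat2_uminus)
  next
    case 2
    then show ?thesis
      using stabilizes_T_inv[OF assms(2)]
      by (intro exI[of _ "matT' q"]) (simp add: inv_psl_class det_mat2)
  qed
next
  case (eng g h)
  then obtain M N where "g = psl_class M" "det M = 1" "stabilizes q M"
    "h = psl_class N" "det N = 1" "stabilizes q N" by blast
  then show ?case
    by (intro exI[of _ "M ** N"]) (simp add: psl_class_mult det_mul stabilizes_mult)
qed

section \<open>The form \<open>[1,1,-1,+]\<close>\<close>

lemma poqf_mem: "poqf (1, 1, -1) 1 \<in> POQF"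
  unfolding POQF_def indefinite_def by fastforce

lemma psi2_form: "psi2 (poqf (1, 1, -1) 1) = psl_class (mat2 1 1 1 2)"
proof -
  have "sqrt 9 = (3::real)" by (rule real_sqrt_unique) simp_all
  then show ?thesis by (simp add: psi2_poqf)
qed

theorem corollary6p2:
  shows "is_group_form PSL2Z (poqf (1, 1, -1) 1) \<and>
         (\<forall>q::nat. q > 3 \<longrightarrow> \<not> is_group_form (hecke_group q) (poqf (1, 1, -1) 1))"
proof (intro conjI allI impI notI)
  have "psl_class (mat2 1 1 1 2) \<in> PSL2Z"
    unfolding PSL2Z_def
    by (rule CollectI, rule exI[of _ 1], rule exI[of _ 1], rule exI[of _ 1], rule exI[of _ 2]) simp
  then show "is_group_form PSL2Z (poqf (1, 1, -1) 1)"
    by (simp add: is_group_form_def poqf_mem psi2_form)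
next
  fix q :: nat
  assume q: "q > 3" and "is_group_form (hecke_group q) (poqf (1, 1, -1) 1)"
  then have "psl_class (mat2 1 1 1 2) \<in> hecke_group q"
    by (simp add: is_group_form_def psi2_form)
  with hecke_group_stabilizes q obtain M
    where M: "psl_class (mat2 1 1 1 2) = psl_class M" and st: "stabilizes q M"
    by (metis less_imp_le)
  from M have "mat2 1 1 1 2 = M \<or> mat2 1 1 1 2 = - M"
    unfolding psl_class_eq by blast
  with st stabilizes_uminus have "stabilizes q (mat2 1 1 1 2)" by metis
  then have "mat2 1 1 1 2 *v vector [1, 0] \<in> full_orbit q"
    using full_orbitI(1)[OF quadrant_orbit.base] by (simp add: stabilizes_def)
  then have "vector [1, 1] \<in> full_orbit q" by (simp add: mat2_vector)
  with one_one_notin_full_orbit[OF q] show False by contradiction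
qed

end
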